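(* Let $H$ be a fixed graph with no isolated vertices. Then \[ \lim_{n\to\infty}\Pr{G(H,n,p)\text{ is connected}}=\begin{cases}0 & p\le p_1^-(H),\\ 1 & p\ge p_1^+(H).\end{cases} \]
   Context: A copy of $H$ in $K_n$ is a subgraph of the complete graph on $[n]$ isomorphic to $H$. $G(H,n,p)$ is the random (multi)graph on $[n]$ obtained by including each copy of $H$ in $K_n$ independently with probability $p$ and taking the union. Let $m_1(H)$ be the number of copies of $H$ in $K_n$ that contain the vertex $1$. Let $\delta(H)$ be the minimum degree of $H$, and for an integer $d\ge 0$ let $\delta_d(H)=\lceil d/\delta(H)\rceil-1$ and \[ p_d^{\pm}(H)=\frac{\ln n+\delta_d(H)\ln\ln n\pm x(n)}{m_1(H)}, \] where $x(n)$ is any function satisfying $1\ll x(n)\ll \ln\ln n$. *)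

theory Defs
  imports "HOL-Probability.Probability" "Graph_Theory.Graph_Theory"
begin

text \<open>
  A simple undirected graph is a \<open>pair_graph\<close>: an edge between \<open>u\<close> and \<open>v\<close> is represented by the
  two arcs \<open>(u, v)\<close> and \<open>(v, u)\<close>, so the degree of a vertex is its out-degree.
\<close>

definition complete_graph :: "nat \<Rightarrow> nat pair_pre_digraph" where
  "complete_graph n = \<lparr>pverts = {1..n}, parcs = {(u, v). u \<in> {1..n} \<and> v \<in> {1..n} \<and> u \<noteq> v}\<rparr>"

lemma complete_digraph_complete_graph: "K\<^bsub>n\<^esub> (with_proj (complete_graph n))"
  by (auto simp: complete_digraph_pair_def complete_graph_def)

definition copies :: "'a pair_pre_digraph \<Rightarrow> nat \<Rightarrow> nat pair_pre_digraph set" where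
  "copies H n = {C. pair_graph C \<and> subgraph (with_proj C) (with_proj (complete_graph n))
                    \<and> digraph_iso (with_proj C) (with_proj H)}"

lemma finite_copies: "finite (copies H n)"
proof (rule finite_subset)
  let ?f = "\<lambda>(V, A). \<lparr>pverts = V, parcs = A\<rparr> :: nat pair_pre_digraph"
  show "copies H n \<subseteq> ?f ` (Pow {1..n} \<times> Pow ({1..n} \<times> {1..n}))"
  proof
    fix C assume "C \<in> copies H n"
    then have "pverts C \<in> Pow {1..n}" "parcs C \<in> Pow ({1..n} \<times> {1..n})"
      by (auto simp: copies_def subgraph_def complete_graph_def)
    moreover have "C = ?f (pverts C, parcs C)" by simp
    ultimately show "C \<in> ?f ` (Pow {1..n} \<times> Pow ({1..n} \<times> {1..n}))" by blast
  qed
qed simp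

definition m1 :: "'a pair_pre_digraph \<Rightarrow> nat \<Rightarrow> nat" where
  "m1 H n = card {C \<in> copies H n. 1 \<in> pverts C}"

text \<open>
  Edge multiplicities in the union are not recorded; they do not affect connectivity.
  The relevant range of \<open>p\<close> is \<open>{0..1}\<close>; outside it \<open>bernoulli_pmf\<close> clamps its parameter.
\<close>

definition random_graph :: "'a pair_pre_digraph \<Rightarrow> nat \<Rightarrow> real \<Rightarrow> nat pair_pre_digraph pmf" where
  "random_graph H n p =
     map_pmf (\<lambda>X. \<lparr>pverts = {1..n}, parcs = (\<Union>C\<in>{C \<in> copies H n. X C}. parcs C)\<rparr>)
       (Pi_pmf (copies H n) False (\<lambda>_. bernoulli_pmf p))"

definition min_degree :: "'a pair_pre_digraph \<Rightarrow> nat" where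
  "min_degree H = Min (out_degree (with_proj H) ` pverts H)"

definition delta_d :: "nat \<Rightarrow> 'a pair_pre_digraph \<Rightarrow> int" where
  "delta_d d H = \<lceil>real d / real (min_degree H)\<rceil> - 1"

definition p_minus :: "nat \<Rightarrow> 'a pair_pre_digraph \<Rightarrow> (nat \<Rightarrow> real) \<Rightarrow> nat \<Rightarrow> real" where
  "p_minus d H x n =
     (ln (real n) + real_of_int (delta_d d H) * ln (ln (real n)) - x n) / real (m1 H n)"

definition p_plus :: "nat \<Rightarrow> 'a pair_pre_digraph \<Rightarrow> (nat \<Rightarrow> real) \<Rightarrow> nat \<Rightarrow> real" where
  "p_plus d H x n =
     (ln (real n) + real_of_int (delta_d d H) * ln (ln (real n)) + x n) / real (m1 H n)"

end

theory Submission
  imports Defs "HOL-Real_Asymp.Real_Asymp"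
begin

text \<open>
  Since the minimum degree is at least 1, \<open>\<delta>\<^sub>1 = 0\<close>, so the threshold is the one for isolated
  vertices, \<open>(ln n \<plusminus> x) / m\<^sub>1\<close>.
  Below it, the number of isolated vertices has mean at least about \<open>e\<^sup>x\<close>; the copies through two
  given vertices are a fraction \<open>O(1/n)\<close> of those through one, so isolation events are almost
  uncorrelated and the second moment method yields an isolated vertex.
  Above it, take a union bound over cuts \<open>S\<close> with \<open>s = |S| \<le> n/2\<close>. As \<open>H\<close> has no isolated vertices,
  a copy meeting \<open>S\<close> in exactly one vertex has an arc leaving \<open>S\<close> even if \<open>H\<close> is disconnected; hence
  at least \<open>s m\<^sub>1 (1 - O(s/n))\<close> copies cross, which handles small \<open>s\<close>. For \<open>s\<close> linear in \<open>n\<close>, averaging over arcs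
  gives \<open>\<Omega>(n m\<^sub>1)\<close> crossing copies, which beats the \<open>2\<^sup>n\<close> choices of \<open>S\<close>.
\<close>

section \<open>Relabelling\<close>

text \<open>Permutations of \<open>{1..n}\<close> act on the copies through \<open>relabel\<close>;
  this symmetry makes the copy counts below independent of the vertices chosen.\<close>

definition relabel :: "('a \<Rightarrow> 'b) \<Rightarrow> 'a pair_pre_digraph \<Rightarrow> 'b pair_pre_digraph" where
  "relabel f G = \<lparr>pverts = f ` pverts G, parcs = map_prod f f ` parcs G\<rparr>"

lemma relabel_simps [simp]:
  "pverts (relabel f G) = f ` pverts G" "parcs (relabel f G) = map_prod f f ` parcs G"
  by (simp_all add: relabel_def)

lemma relabel_relabel: "relabel g (relabel f G) = relabel (g \<circ> f) G"
  by (simp add: relabel_def image_comp map_prod.comp)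

lemma relabel_id [simp]: "relabel id G = G"
  by (simp add: relabel_def map_prod.id)

lemma pair_graph_iff:
  "pair_graph G \<longleftrightarrow> finite (pverts G) \<and> (\<forall>u v. (u, v) \<in> parcs G \<longrightarrow>
     u \<in> pverts G \<and> v \<in> pverts G \<and> u \<noteq> v \<and> (v, u) \<in> parcs G)"
proof
  assume "pair_graph G"
  then interpret pair_graph G .
  show "finite (pverts G) \<and> (\<forall>u v. (u, v) \<in> parcs G \<longrightarrow>
     u \<in> pverts G \<and> v \<in> pverts G \<and> u \<noteq> v \<and> (v, u) \<in> parcs G)"
    using pair_finite_verts in_arcsD1 in_arcsD2 pair_no_loops pair_sym_arcs
    by (fastforce simp: symmetric_def dest: symD)
next
  assume G: "finite (pverts G) \<and> (\<forall>u v. (u, v) \<in> parcs G \<longrightarrow>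
     u \<in> pverts G \<and> v \<in> pverts G \<and> u \<noteq> v \<and> (v, u) \<in> parcs G)"
  then have "parcs G \<subseteq> pverts G \<times> pverts G" by auto
  with G have "finite (parcs G)" by (meson finite_SigmaI finite_subset)
  with G show "pair_graph G"
    by unfold_locales (auto simp: symmetric_def sym_def)
qed

lemma pair_graph_relabel:
  assumes "pair_graph G" "inj_on f (pverts G)"
  shows "pair_graph (relabel f G)"
proof -
  have "u \<in> pverts G \<and> v \<in> pverts G \<and> u \<noteq> v \<and> (v, u) \<in> parcs G" if "(u, v) \<in> parcs G" for u v
    using assms(1) that by (auto simp: pair_graph_iff)
  note arcs = this
  have "finite (pverts G)" using assms(1) by (simp add: pair_graph_iff)
  moreover have "f u \<in> f ` pverts G \<and> f v \<in> f ` pverts G \<and> f u \<noteq> f v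
      \<and> (f v, f u) \<in> map_prod f f ` parcs G" if "(u, v) \<in> parcs G" for u v
    using arcs[OF that] assms(2) by (auto simp: inj_on_eq_iff intro: rev_image_eqI)
  ultimately show ?thesis unfolding pair_graph_iff by auto
qed

lemma pair_graph_wf_digraph: "pair_graph G \<Longrightarrow> wf_digraph (with_proj G)"
  by (simp add: graph.axioms digraph.axioms fin_digraph.axioms(1) pair_graph.pair_graphD_graph)

lemma digraph_iso_relabel:
  assumes "pair_graph G" "inj_on f (pverts G)"
  shows "digraph_iso (with_proj G) (with_proj (relabel f G))"
proof -
  let ?h = "\<lparr>iso_verts = f, iso_arcs = map_prod f f, iso_head = snd, iso_tail = fst\<rparr>"
  have sub: "parcs G \<subseteq> pverts G \<times> pverts G"
    using assms(1) by (auto simp: pair_graph_iff)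
  have "inj_on (map_prod f f) (parcs G)"
    using assms(2) sub by (auto simp: inj_on_def subset_iff map_prod_def split: prod.splits)
  then have "pre_digraph.digraph_isomorphism (with_proj G) ?h"
    using assms pair_graph_wf_digraph[OF assms(1)] by (simp add: pre_digraph.digraph_isomorphism_def)
  moreover have "with_proj (relabel f G) = app_iso ?h (with_proj G)"
    by (simp add: app_iso_def with_proj_def)
  ultimately show ?thesis by (auto simp: digraph_iso_def)
qed

text \<open>A loop-free graph on a subset of \<open>{1..n}\<close> has all its arcs in the complete
  graph, so the subgraph condition reduces to one on the vertex set.\<close>

lemma copies_iff:
  "C \<in> copies H n \<longleftrightarrow>
     pair_graph C \<and> pverts C \<subseteq> {1..n} \<and> digraph_iso (with_proj C) (with_proj H)"
proof -
  have "subgraph (with_proj C) (with_proj (complete_graph n))"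
    if C: "pair_graph C" "pverts C \<subseteq> {1..n}"
  proof -
    have "parcs C \<subseteq> parcs (complete_graph n)"
      using C unfolding complete_graph_def pair_graph_iff by clarsimp (metis atLeastAtMost_iff subsetD)
    moreover have "wf_digraph (with_proj (complete_graph n))"
      by (rule pair_graph_wf_digraph) (auto simp: pair_graph_iff complete_graph_def)
    ultimately show ?thesis
      using C pair_graph_wf_digraph[OF C(1)]
      by (auto simp: subgraph_def compatible_def complete_graph_def)
  qed
  moreover have "pverts C \<subseteq> {1..n}" if "subgraph (with_proj C) (with_proj (complete_graph n))"
    using that by (auto simp: subgraph_def complete_graph_def)
  ultimately show ?thesis unfolding copies_def by blast
qed

text \<open>The two cardinalities feed the double counts; the equality of degree sets transfers the
  absence of isolated vertices from \<open>H\<close> to every copy.\<close>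

lemma digraph_iso_invariants:
  assumes "digraph_iso (with_proj C) (with_proj H)"
  shows "card (pverts C) = card (pverts H)" "card (parcs C) = card (parcs H)"
    "out_degree (with_proj C) ` pverts C = out_degree (with_proj H) ` pverts H"
proof -
  obtain h where h: "pre_digraph.digraph_isomorphism (with_proj C) h"
    "with_proj H = app_iso h (with_proj C)"
    using assms by (auto simp: digraph_iso_def)
  have v: "pverts H = iso_verts h ` pverts C" and a: "parcs H = iso_arcs h ` parcs C"
    using h(2) by (metis verts_app_iso with_proj_simps(1), metis arcs_app_iso with_proj_simps(2))
  have "inj_on (iso_verts h) (pverts C)" "inj_on (iso_arcs h) (parcs C)"
    using h(1) by (auto simp: pre_digraph.digraph_isomorphism_def)
  then show "card (pverts C) = card (pverts H)" "card (parcs C) = card (parcs H)"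
    unfolding v a by (simp_all add: card_image)
  have wf: "wf_digraph (with_proj C)"
    using h(1) by (simp add: pre_digraph.digraph_isomorphism_def)
  have "out_degree (with_proj H) (iso_verts h u) = out_degree (with_proj C) u"
    if "u \<in> pverts C" for u
    using h that wf_digraph.out_degree_app_iso_eq[OF wf h(1)] by simp
  then show "out_degree (with_proj C) ` pverts C = out_degree (with_proj H) ` pverts H"
    unfolding v by (force simp: image_iff)
qed

lemma relabel_copies:
  assumes "C \<in> copies H n" "bij_betw \<pi> {1..n} {1..n}"
  shows "relabel \<pi> C \<in> copies H n"
proof -
  have C: "pair_graph C" "pverts C \<subseteq> {1..n}" "digraph_iso (with_proj C) (with_proj H)"
    using assms(1) by (auto simp: copies_iff)
  have inj: "inj_on \<pi> (pverts C)"
    using assms(2) C(2) by (meson bij_betw_imp_inj_on inj_on_subset)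
  have "digraph_iso (with_proj (relabel \<pi> C)) (with_proj C)"
    using digraph_iso_swap[OF pair_graph_wf_digraph[OF C(1)] digraph_iso_relabel[OF C(1) inj]] .
  then have "digraph_iso (with_proj (relabel \<pi> C)) (with_proj H)"
    using C(3) by (rule digraph_iso_trans)
  moreover have "\<pi> ` pverts C \<subseteq> {1..n}"
    using C(2) assms(2) unfolding bij_betw_def by blast
  ultimately show ?thesis
    using pair_graph_relabel[OF C(1) inj] by (simp add: copies_iff)
qed

text \<open>Relabelling by \<open>\<pi>\<close> is a bijection of the copies, with relabelling by
  \<open>inv \<pi>\<close> as its inverse.\<close>

lemma card_copies_permute:
  assumes \<pi>: "\<pi> permutes {1..n}"
    and PQ: "\<And>C. C \<in> copies H n \<Longrightarrow> P C \<longleftrightarrow> Q (relabel \<pi> C)"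
  shows "card {C \<in> copies H n. P C} = card {C \<in> copies H n. Q C}"
proof (rule bij_betw_same_card)
  have inv: "relabel (inv \<pi>) (relabel \<pi> C) = C" "relabel \<pi> (relabel (inv \<pi>) C) = C"
    for C :: "nat pair_pre_digraph"
    using permutes_inv_o[OF \<pi>] by (simp_all add: relabel_relabel)
  show "bij_betw (relabel \<pi>) {C \<in> copies H n. P C} {C \<in> copies H n. Q C}"
  proof (rule bij_betw_byWitness[where f' = "relabel (inv \<pi>)"])
    show "relabel \<pi> ` {C \<in> copies H n. P C} \<subseteq> {C \<in> copies H n. Q C}"
      using PQ relabel_copies permutes_imp_bij[OF \<pi>] by auto
    show "relabel (inv \<pi>) ` {C \<in> copies H n. Q C} \<subseteq> {C \<in> copies H n. P C}"
    proof safe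
      fix C assume C: "C \<in> copies H n" "Q C"
      show "relabel (inv \<pi>) C \<in> copies H n"
        using C relabel_copies permutes_imp_bij[OF permutes_inv[OF \<pi>]] by blast
      then show "P (relabel (inv \<pi>) C)" using C PQ inv by simp
    qed
  qed (auto simp: inv)
qed

text \<open>Two transpositions suffice for 2-transitivity: the first moves \<open>u\<close> to
  \<open>u'\<close>, the second repairs the image of \<open>w\<close>.\<close>

lemma exists_permutation_pair:
  assumes "u \<in> A" "w \<in> A" "u' \<in> A" "w' \<in> A" "u \<noteq> w" "u' \<noteq> w'"
  obtains \<pi> where "\<pi> permutes A" "\<pi> u = u'" "\<pi> w = w'"
proof -
  let ?\<sigma> = "Transposition.transpose u u'"
  let ?\<tau> = "Transposition.transpose (?\<sigma> w) w'"
  have \<sigma>: "?\<sigma> permutes A" using assms by (simp add: permutes_swap_id)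
  have "?\<sigma> w \<in> A" using permutes_in_image[OF \<sigma>] assms by simp
  then have "?\<tau> permutes A" using assms by (simp add: permutes_swap_id)
  with \<sigma> have "?\<tau> \<circ> ?\<sigma> permutes A" by (rule permutes_compose)
  \<comment> \<open>Neither point swapped by \<open>?\<tau>\<close> is \<open>u'\<close>, so
    \<open>?\<tau>\<close> leaves the image of \<open>u\<close> in place.\<close>
  moreover have "?\<sigma> w \<noteq> u'" using assms by (metis transpose_apply_first transpose_involutory)
  then have "(?\<tau> \<circ> ?\<sigma>) u = u'" using assms by simp
  moreover have "(?\<tau> \<circ> ?\<sigma>) w = w'" by simp
  ultimately show thesis using that by blast
qed

section \<open>Counting copies\<close>

text \<open>Arcs of a copy come in opposite pairs, so it is enough to ask for one going out of
  \<open>S\<close>. No edge of the union graph leaves \<open>S\<close> exactly when all these copies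
  are absent.\<close>

definition crossing :: "'a pair_pre_digraph \<Rightarrow> nat \<Rightarrow> nat set \<Rightarrow> nat pair_pre_digraph set" where
  "crossing H n S = {C \<in> copies H n. \<exists>(u, w) \<in> parcs C. u \<in> S \<and> w \<notin> S}"

text \<open>The analogue of \<open>m1\<close> for two vertices. It measures both the correlation of
  two isolation events and the overcount of copies that meet a cut in several vertices.\<close>

definition m2 :: "'a pair_pre_digraph \<Rightarrow> nat \<Rightarrow> nat" where
  "m2 H n = card {C \<in> copies H n. 1 \<in> pverts C \<and> 2 \<in> pverts C}"

section \<open>Independence of the counts from the chosen vertices\<close>

lemma card_copies_containing:
  assumes "u \<in> {1..n}"
  shows "card {C \<in> copies H n. u \<in> pverts C} = m1 H n"
  unfolding m1_def
proof (rule card_copies_permute)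
  show "Transposition.transpose u 1 permutes {1..n}"
    using assms by (intro permutes_swap_id) auto
  show "u \<in> pverts C \<longleftrightarrow> 1 \<in> pverts (relabel (Transposition.transpose u 1) C)" for C
    by (simp add: in_transpose_image_iff)
qed

lemma card_copies_containing_pair:
  assumes "u \<in> {1..n}" "w \<in> {1..n}" "u \<noteq> w"
  shows "card {C \<in> copies H n. u \<in> pverts C \<and> w \<in> pverts C} = m2 H n"
proof -
  have "1 \<in> {1..n}" "2 \<in> {1..n}" using assms by auto
  then obtain \<pi> where \<pi>: "\<pi> permutes {1..n}" "\<pi> u = 1" "\<pi> w = 2"
    using exists_permutation_pair[of u "{1..n}" w 1 2] assms by auto
  have "u \<in> pverts C \<and> w \<in> pverts C \<longleftrightarrow>
      1 \<in> pverts (relabel \<pi> C) \<and> 2 \<in> pverts (relabel \<pi> C)" for C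
    using \<pi>(2,3) permutes_inj[OF \<pi>(1)] by (metis inj_image_mem_iff relabel_simps(1))
  then show ?thesis unfolding m2_def by (rule card_copies_permute[OF \<pi>(1)])
qed

lemma card_copies_containing_arc:
  assumes "u \<in> {1..n}" "w \<in> {1..n}" "u \<noteq> w"
  shows "card {C \<in> copies H n. (u, w) \<in> parcs C} = card {C \<in> copies H n. (1, 2) \<in> parcs C}"
proof -
  have "1 \<in> {1..n}" "2 \<in> {1..n}" using assms by auto
  then obtain \<pi> where \<pi>: "\<pi> permutes {1..n}" "\<pi> u = 1" "\<pi> w = 2"
    using exists_permutation_pair[of u "{1..n}" w 1 2] assms by auto
  have inj: "inj (map_prod \<pi> \<pi>)"
    using permutes_inj[OF \<pi>(1)] by (simp add: prod.inj_map)
  have "(1, 2) = map_prod \<pi> \<pi> (u, w)" using \<pi> by simp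
  then have "(u, w) \<in> parcs C \<longleftrightarrow> (1, 2) \<in> parcs (relabel \<pi> C)" for C
    by (metis inj_image_mem_iff[OF inj] relabel_simps(2))
  then show ?thesis by (rule card_copies_permute[OF \<pi>(1)])
qed

lemma card_off_diagonal: "card {(u, w). u \<in> {1..n} \<and> w \<in> {1..n} \<and> u \<noteq> w} = n * (n - 1)"
proof -
  have "{(u, w). u \<in> {1..n} \<and> w \<in> {1..n} \<and> u \<noteq> w} = (SIGMA u:{1..n}. {1..n} - {u})"
    by auto
  then show ?thesis by simp
qed

locale no_isolated_graph =
  fixes H :: "'a pair_pre_digraph"
  assumes graph: "pair_graph H" and nonempty: "pverts H \<noteq> {}"
    and no_isolated: "\<And>v. v \<in> pverts H \<Longrightarrow> out_degree (with_proj H) v \<noteq> 0"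
begin

abbreviation order :: nat where "order \<equiv> card (pverts H)"

text \<open>The out-degree of \<open>u\<close> in \<open>C\<close> occurs as an out-degree in
  \<open>H\<close>, hence is not zero.\<close>

lemma has_neighbour:
  assumes "C \<in> copies H n" "u \<in> pverts C"
  obtains w where "(u, w) \<in> parcs C" "w \<in> pverts C" "w \<noteq> u"
proof -
  have C: "pair_graph C" "digraph_iso (with_proj C) (with_proj H)"
    using assms by (auto simp: copies_iff)
  have "out_degree (with_proj C) u \<in> out_degree (with_proj H) ` pverts H"
    using digraph_iso_invariants(3)[OF C(2)] assms(2) by blast
  then have "out_degree (with_proj C) u \<noteq> 0" using no_isolated by auto
  then obtain e where "e \<in> out_arcs (with_proj C) u"
    unfolding out_degree_def by (metis card.empty ex_in_conv)
  then have "(u, snd e) \<in> parcs C" by (auto simp: out_arcs_def)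
  then show thesis using that C(1) by (metis pair_graph_iff)
qed

lemma copies_nonempty:
  assumes "order \<le> n"
  shows "copies H n \<noteq> {}"
proof -
  have "finite (pverts H)" using graph by (simp add: pair_graph_iff)
  then obtain f where f: "inj_on f (pverts H)" "f ` pverts H \<subseteq> {1..n}"
    using assms card_le_inj[of "pverts H" "{1..n}"] by auto
  have "relabel f H \<in> copies H n"
    using f pair_graph_relabel[OF graph f(1)]
      digraph_iso_swap[OF pair_graph_wf_digraph[OF graph] digraph_iso_relabel[OF graph f(1)]]
    by (simp add: copies_iff)
  then show ?thesis by blast
qed

lemma copies_verts:
  assumes "C \<in> copies H n"
  shows "pverts C \<subseteq> {1..n}" "card (pverts C) = order" "finite (pverts C)"
    "card (parcs C) = card (parcs H)" "finite (parcs C)" "parcs C \<subseteq> pverts C \<times> pverts C"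
proof -
  have C: "pair_graph C" "pverts C \<subseteq> {1..n}" "digraph_iso (with_proj C) (with_proj H)"
    using assms by (auto simp: copies_iff)
  show "pverts C \<subseteq> {1..n}" "card (pverts C) = order" "card (parcs C) = card (parcs H)"
    using C digraph_iso_invariants[OF C(3)] by auto
  show fin: "finite (pverts C)" and sub: "parcs C \<subseteq> pverts C \<times> pverts C"
    using C by (auto simp: pair_graph_iff)
  then show "finite (parcs C)" by (meson finite_SigmaI finite_subset)
qed

lemma arcs_pos: "card (parcs H) > 0"
proof -
  obtain v where "v \<in> pverts H" using nonempty by blast
  then have "out_arcs (with_proj H) v \<noteq> {}"
    using no_isolated unfolding out_degree_def by force
  then have "parcs H \<noteq> {}" by (auto simp: out_arcs_def)
  moreover have "finite (pverts H)" "parcs H \<subseteq> pverts H \<times> pverts H"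
    using graph by (auto simp: pair_graph_iff)
  ultimately show ?thesis by (meson card_gt_0_iff finite_SigmaI finite_subset)
qed

lemma order_ge_2: "order \<ge> 2"
proof -
  obtain u w where "(u, w) \<in> parcs H" using arcs_pos by (metis card.empty equals0I less_numeral_extra(3) surj_pair)
  then have "{u, w} \<subseteq> pverts H" "u \<noteq> w" "finite (pverts H)"
    using graph by (auto simp: pair_graph_iff)
  then show ?thesis by (metis card_2_iff card_mono)
qed

text \<open>Double count of the pairs of a copy and a vertex in it.\<close>

lemma vertex_count: "n * m1 H n = card (copies H n) * order"
proof -
  have "(\<Sum>u\<in>{1..n}. card {C \<in> copies H n. u \<in> pverts C}) = (\<Sum>C\<in>copies H n. order)"
  proof (rule sum_multicount_gen)
    show "\<forall>C\<in>copies H n. card {u \<in> {1..n}. u \<in> pverts C} = order"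
    proof
      fix C assume C: "C \<in> copies H n"
      then have "{u \<in> {1..n}. u \<in> pverts C} = pverts C" using copies_verts(1) by blast
      with C show "card {u \<in> {1..n}. u \<in> pverts C} = order" by (simp add: copies_verts)
    qed
  qed (auto simp: finite_copies)
  then show ?thesis by (simp add: card_copies_containing)
qed

text \<open>Double count of the pairs of a copy and an arc in it; the arcs available are the ordered
  pairs of distinct vertices.\<close>

lemma arc_count:
  "n * (n - 1) * card {C \<in> copies H n. (1, 2) \<in> parcs C} = card (copies H n) * card (parcs H)"
proof -
  let ?P = "{(u, w). u \<in> {1..n} \<and> w \<in> {1..n} \<and> u \<noteq> w}"
  have "finite ?P" by (rule finite_subset[of _ "{1..n} \<times> {1..n}"]) auto
  then have "(\<Sum>e\<in>?P. card {C \<in> copies H n. e \<in> parcs C}) = (\<Sum>C\<in>copies H n. card (parcs H))"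
  proof (rule sum_multicount_gen)
    show "\<forall>C\<in>copies H n. card {e \<in> ?P. e \<in> parcs C} = card (parcs H)"
    proof
      fix C assume C: "C \<in> copies H n"
      then have "{e \<in> ?P. e \<in> parcs C} = parcs C"
        using copies_verts(1,6)[OF C] C by (auto simp: copies_iff pair_graph_iff)
      with C show "card {e \<in> ?P. e \<in> parcs C} = card (parcs H)" by (simp add: copies_verts)
    qed
  qed (auto simp: finite_copies)
  moreover have "card {C \<in> copies H n. e \<in> parcs C} = card {C \<in> copies H n. (1, 2) \<in> parcs C}"
    if "e \<in> ?P" for e
    using that card_copies_containing_arc[of "fst e" n "snd e"] by auto
  then have "(\<Sum>e\<in>?P. card {C \<in> copies H n. e \<in> parcs C}) =
      (\<Sum>e\<in>?P. card {C \<in> copies H n. (1, 2) \<in> parcs C})"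
    by (rule sum.cong[OF refl])
  ultimately show ?thesis by (simp only: sum_constant card_off_diagonal of_nat_id)
qed

text \<open>Double count of the pairs of a copy through 1 and a further vertex of it. Thus
  \<open>m2\<close> is the fraction \<open>(order - 1) / (n - 1)\<close> of
  \<open>m1\<close>.\<close>

lemma pair_count:
  assumes "n \<ge> 1"
  shows "(n - 1) * m2 H n = m1 H n * (order - 1)"
proof -
  let ?T = "{C \<in> copies H n. 1 \<in> pverts C}"
  have "(\<Sum>w\<in>{2..n}. card {C \<in> ?T. w \<in> pverts C}) = (\<Sum>C\<in>?T. order - 1)"
  proof (rule sum_multicount_gen)
    show "\<forall>C\<in>?T. card {w \<in> {2..n}. w \<in> pverts C} = order - 1"
    proof
      fix C assume C: "C \<in> ?T"
      then have "{w \<in> {2..n}. w \<in> pverts C} = pverts C - {1}"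
        using copies_verts(1)[of C n] by fastforce
      then show "card {w \<in> {2..n}. w \<in> pverts C} = order - 1"
        using C copies_verts(2,3)[of C n] by (metis (no_types, lifting) card_Diff_singleton mem_Collect_eq)
    qed
  qed (auto simp: finite_copies)
  moreover have "card {C \<in> ?T. w \<in> pverts C} = m2 H n" if "w \<in> {2..n}" for w
    using that card_copies_containing_pair[of 1 n w] by (simp add: conj_assoc)
  ultimately show ?thesis by (simp add: m1_def)
qed

lemma m1_pos:
  assumes "order \<le> n"
  shows "m1 H n > 0"
proof -
  have "card (copies H n) * order > 0"
    using copies_nonempty[OF assms] finite_copies[of H n] order_ge_2
    by (metis card_gt_0_iff nat_0_less_mult_iff pos2 order_less_le_trans)
  then show ?thesis using vertex_count[of n] by (metis gr0I mult_0_right)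
qed

text \<open>The pair count forces \<open>m2\<close> to be positive, hence at least 1. The resulting
  linear growth of \<open>m1\<close> makes threshold probabilities
  \<open>O(ln n / n)\<close>.\<close>

lemma m1_ge:
  assumes "order \<le> n"
  shows "real n - 1 \<le> m1 H n * (real order - 1)"
proof -
  have "m1 H n * (order - 1) > 0" using m1_pos[OF assms] order_ge_2 by simp
  then have "m2 H n > 0" using pair_count[of n] assms order_ge_2 by (metis gr0I le_trans mult_0_right one_le_numeral)
  then have "n - 1 \<le> m1 H n * (order - 1)" using pair_count[of n] assms order_ge_2
    by (metis One_nat_def Suc_leI le_trans mult.right_neutral mult_le_mono2 one_le_numeral)
  then have "real (n - 1) \<le> real (m1 H n * (order - 1))" by (rule of_nat_mono)
  then show ?thesis using order_ge_2 assms by (simp add: of_nat_diff)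
qed

text \<open>
  A copy meeting \<open>S\<close> only in \<open>u\<close> (a member of \<open>A u - B u\<close> in the proof) crosses, as \<open>u\<close> is not
  isolated in it; these families are disjoint for distinct \<open>u\<close>.
\<close>

lemma crossing_ge_inclusion_exclusion:
  assumes "S \<subseteq> {1..n}"
  shows "card S * m1 H n \<le> card (crossing H n S) + card S * (card S - 1) * m2 H n"
proof -
  have fin: "finite S" using assms finite_subset by blast
  define A where "A u = {C \<in> copies H n. u \<in> pverts C}" for u
  define B where "B u = (\<Union>w\<in>S - {u}. {C \<in> copies H n. u \<in> pverts C \<and> w \<in> pverts C})" for u
  have finAB: "finite (A u)" "finite (B u)" for u
    using fin by (auto simp: A_def B_def finite_copies)
  have "card (B u) \<le> (card S - 1) * m2 H n" if "u \<in> S" for u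
  proof -
    have "card (B u) \<le> (\<Sum>w\<in>S - {u}. card {C \<in> copies H n. u \<in> pverts C \<and> w \<in> pverts C})"
      unfolding B_def using fin by (intro card_UN_le) auto
    also have "\<dots> = (\<Sum>w\<in>S - {u}. m2 H n)"
      using assms that by (intro sum.cong card_copies_containing_pair) auto
    finally show ?thesis using fin that by simp
  qed
  then have "card S * (card S - 1) * m2 H n \<ge> (\<Sum>u\<in>S. card (B u))"
    using sum_bounded_above[of S "\<lambda>u. card (B u)" "(card S - 1) * m2 H n"] by (simp add: mult.assoc)
  moreover have "(\<Sum>u\<in>S. card (A u)) = card S * m1 H n"
    using assms by (simp add: A_def card_copies_containing subset_iff)
  moreover have "(\<Sum>u\<in>S. card (A u)) \<le> (\<Sum>u\<in>S. card (A u - B u)) + (\<Sum>u\<in>S. card (B u))"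
  proof -
    have "card (A u) \<le> card (A u - B u) + card (B u)" for u
      using diff_card_le_card_Diff[of "B u" "A u"] finAB by simp
    then show ?thesis by (simp add: sum_mono flip: sum.distrib)
  qed
  moreover have "(\<Sum>u\<in>S. card (A u - B u)) = card (\<Union>u\<in>S. A u - B u)"
    using fin finAB by (intro card_UN_disjoint[symmetric]) (auto simp: A_def B_def)
  moreover have "(\<Union>u\<in>S. A u - B u) \<subseteq> crossing H n S"
  proof
    fix C assume "C \<in> (\<Union>u\<in>S. A u - B u)"
    then obtain u where u: "u \<in> S" "C \<in> copies H n" "u \<in> pverts C"
      "\<And>w. w \<in> S - {u} \<Longrightarrow> w \<notin> pverts C" by (auto simp: A_def B_def)
    obtain w where "(u, w) \<in> parcs C" "w \<in> pverts C" "w \<noteq> u" by (rule has_neighbour[OF u(2,3)])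
    then show "C \<in> crossing H n S" using u by (auto simp: crossing_def)
  qed
  then have "card (\<Union>u\<in>S. A u - B u) \<le> card (crossing H n S)"
    by (intro card_mono) (auto simp: crossing_def finite_copies)
  ultimately show ?thesis by linarith
qed

text \<open>
  Each of the \<open>s (n - s)\<close> arcs leaving \<open>S\<close> lies in equally many copies, and a copy is counted
  at most once per arc of \<open>H\<close>.
\<close>

lemma crossing_ge_arcs:
  assumes S: "S \<subseteq> {1..n}"
  shows "card S * (n - card S) * m1 H n \<le> order * (n - 1) * card (crossing H n S)"
proof (cases "n = 0")
  case False
  let ?E = "S \<times> ({1..n} - S)"
  let ?m = "card {C \<in> copies H n. (1, 2) \<in> parcs C}"
  have fin: "finite S" using S finite_subset by blast
  have "(\<Sum>e\<in>?E. card {C \<in> crossing H n S. e \<in> parcs C}) =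
      (\<Sum>C\<in>crossing H n S. card {e \<in> ?E. e \<in> parcs C})"
    using fin by (intro sum_multicount_gen) (auto simp: crossing_def finite_copies)
  moreover have "card {C \<in> crossing H n S. e \<in> parcs C} = ?m" if "e \<in> ?E" for e
  proof -
    have "{C \<in> crossing H n S. e \<in> parcs C} = {C \<in> copies H n. e \<in> parcs C}"
      using that by (auto simp: crossing_def)
    moreover have "fst e \<in> {1..n}" "snd e \<in> {1..n}" "fst e \<noteq> snd e" using that S by auto
    ultimately show ?thesis using card_copies_containing_arc[of "fst e" n "snd e" H] by simp
  qed
  moreover have "card ?E = card S * (n - card S)"
    using S fin by (simp add: card_cartesian_product card_Diff_subset)
  moreover have "card {e \<in> ?E. e \<in> parcs C} \<le> card (parcs H)" if "C \<in> crossing H n S" for C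
  proof -
    have "C \<in> copies H n" using that by (simp add: crossing_def)
    then show ?thesis using copies_verts[of C n] by (metis (no_types, lifting) card_mono mem_Collect_eq subsetI)
  qed
  then have "(\<Sum>C\<in>crossing H n S. card {e \<in> ?E. e \<in> parcs C}) \<le>
      card (crossing H n S) * card (parcs H)"
    using sum_bounded_above[of "crossing H n S" "\<lambda>C. card {e \<in> ?E. e \<in> parcs C}" "card (parcs H)"]
    by (simp only: of_nat_id)
  ultimately have "card S * (n - card S) * ?m \<le> card (crossing H n S) * card (parcs H)"
    by simp
  \<comment> \<open>This factor lets the arc count and the vertex count turn \<open>?m\<close> into
    \<open>m1 H n\<close> without division of naturals; afterwards \<open>n * card (parcs H)\<close>
    cancels.\<close>
  then have "card S * (n - card S) * ?m * (n * (n - 1) * order) \<le>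
      card (crossing H n S) * card (parcs H) * (n * (n - 1) * order)"
    by (rule mult_le_mono1)
  moreover have "card S * (n - card S) * ?m * (n * (n - 1) * order) =
      (card S * (n - card S) * m1 H n) * (n * card (parcs H))"
    using arc_count[of n] vertex_count[of n] by algebra
  ultimately have "(n * card (parcs H)) * (card S * (n - card S) * m1 H n) \<le>
      (n * card (parcs H)) * (order * (n - 1) * card (crossing H n S))"
    by (simp only: ac_simps)
  then show ?thesis using False arcs_pos by simp
qed (use S in auto)

end

section \<open>Probability estimates\<close>

text \<open>Chebyshev's inequality for the number \<open>X\<close> of events that occur: if none
  occurs, \<open>X\<close> misses its mean by the whole mean. The variance is computed exactly, and
  the nonpositive term \<open>- r / (?n * q\<^sup>2)\<close> is dropped at the end.\<close>

lemma second_moment_none: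
  fixes M :: "'b pmf" and E :: "'i \<Rightarrow> 'b set" and q r :: real
  assumes fin: "finite I" "I \<noteq> {}" and q: "q > 0" "\<And>i. i \<in> I \<Longrightarrow> measure_pmf.prob M (E i) = q"
    and r: "\<And>i j. i \<in> I \<Longrightarrow> j \<in> I \<Longrightarrow> i \<noteq> j \<Longrightarrow> measure_pmf.prob M (E i \<inter> E j) = r"
    and "r \<ge> 0"
  shows "measure_pmf.prob M {\<omega>. \<forall>i\<in>I. \<omega> \<notin> E i} \<le> 1 / (card I * q) + r / q\<^sup>2 - 1"
proof -
  define X :: "'b \<Rightarrow> real" where "X \<omega> = (\<Sum>i\<in>I. indicator (E i) \<omega>)" for \<omega>
  let ?n = "real (card I)"
  have n: "?n > 0" using fin by (simp add: card_gt_0_iff)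
  have int: "integrable (measure_pmf M) (indicator A :: 'b \<Rightarrow> real)" for A
    by (rule measure_pmf.integrable_const_bound[where B = 1]) auto
  have EX: "measure_pmf.expectation M X = ?n * q"
    unfolding X_def using q int by (simp add: Bochner_Integration.integral_sum int)
  have sq: "X \<omega> ^ 2 = (\<Sum>i\<in>I. \<Sum>j\<in>I. indicator (E i \<inter> E j) \<omega>)" for \<omega>
    by (simp add: X_def power2_eq_square sum_product indicator_inter_arith)
  have "measure_pmf.expectation M (\<lambda>\<omega>. X \<omega> ^ 2) = (\<Sum>i\<in>I. \<Sum>j\<in>I. measure_pmf.prob M (E i \<inter> E j))"
    unfolding sq by (simp add: Bochner_Integration.integral_sum int)
  also have "\<dots> = (\<Sum>i\<in>I. q + (?n - 1) * r)"
  proof (rule sum.cong[OF refl])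
    fix i assume i: "i \<in> I"
    have "(\<Sum>j\<in>I. measure_pmf.prob M (E i \<inter> E j)) =
        q + (\<Sum>j\<in>I - {i}. measure_pmf.prob M (E i \<inter> E j))"
      using i fin q(2) by (simp add: sum.remove)
    also have "(\<Sum>j\<in>I - {i}. measure_pmf.prob M (E i \<inter> E j)) = (\<Sum>j\<in>I - {i}. r)"
      using i r by (intro sum.cong) auto
    finally show "(\<Sum>j\<in>I. measure_pmf.prob M (E i \<inter> E j)) = q + (?n - 1) * r"
      using i fin n by (simp add: of_nat_diff Suc_leI card_gt_0_iff)
  qed
  finally have EX2: "measure_pmf.expectation M (\<lambda>\<omega>. X \<omega> ^ 2) = ?n * (q + (?n - 1) * r)"
    by simp
  have "measure_pmf.prob M {\<omega>. \<forall>i\<in>I. \<omega> \<notin> E i}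
      \<le> measure_pmf.prob M {\<omega> \<in> space (measure_pmf M). \<bar>X \<omega> - measure_pmf.expectation M X\<bar> \<ge> ?n * q}"
    using n q by (intro measure_pmf.finite_measure_mono) (auto simp: EX X_def)
  also have "\<dots> \<le> measure_pmf.variance M X / (?n * q)\<^sup>2"
  proof (rule measure_pmf.Chebyshev_inequality)
    show "integrable (measure_pmf M) (\<lambda>\<omega>. (X \<omega>)\<^sup>2)"
      unfolding sq by (intro Bochner_Integration.integrable_sum int)
  qed (use n q in auto)
  also have "measure_pmf.variance M X = ?n * (q + (?n - 1) * r) - (?n * q)\<^sup>2"
  proof -
    have "integrable (measure_pmf M) X"
      unfolding X_def by (intro Bochner_Integration.integrable_sum int)
    moreover have "integrable (measure_pmf M) (\<lambda>\<omega>. (X \<omega>)\<^sup>2)"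
      unfolding sq by (intro Bochner_Integration.integrable_sum int)
    ultimately have "measure_pmf.variance M X =
        measure_pmf.expectation M (\<lambda>\<omega>. (X \<omega>)\<^sup>2) - (measure_pmf.expectation M X)\<^sup>2"
      by (rule measure_pmf.variance_eq)
    then show ?thesis by (simp only: EX EX2)
  qed
  also have "(?n * (q + (?n - 1) * r) - (?n * q)\<^sup>2) / (?n * q)\<^sup>2
      = 1 / (?n * q) + r / q\<^sup>2 - r / (?n * q\<^sup>2) - 1"
    using n q by (simp add: field_simps power2_eq_square)
  also have "\<dots> \<le> 1 / (?n * q) + r / q\<^sup>2 - 1"
    using n q \<open>r \<ge> 0\<close> by simp
  finally show ?thesis .
qed

section \<open>Connectivity, isolated vertices and cuts\<close>

lemma rtrancl_on_first_step:
  assumes "(a, b) \<in> rtrancl_on F R"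
  shows "a = b \<or> (\<exists>c. (a, c) \<in> R)"
  using assms by induction auto

lemma connected_imp_incident_arc:
  assumes "Digraph_Component.connected (with_proj G)" "u \<in> pverts G" "w \<in> pverts G" "u \<noteq> w"
  obtains c where "(u, c) \<in> parcs G \<or> (c, u) \<in> parcs G"
proof -
  have "(u, w) \<in> rtrancl_on (pverts G) ((parcs G)\<^sup>s)"
    using assms by (simp add: connected_conv)
  from rtrancl_on_first_step[OF this] assms(4) obtain c where "(u, c) \<in> (parcs G)\<^sup>s" by blast
  then show thesis using that by (auto simp: symcl_def)
qed

text \<open>Take the set of vertices reachable from some \<open>u\<close> that fails to reach some
  \<open>w\<close>. By symmetry of the arcs its complement is closed as well, so the smaller of the
  two serves as \<open>S\<close>.\<close>

lemma not_connected_small_cut: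
  assumes fin: "finite (pverts G)" "pverts G \<noteq> {}"
    and arcs: "parcs G \<subseteq> pverts G \<times> pverts G" "sym (parcs G)"
    and disc: "\<not> Digraph_Component.connected (with_proj G)"
  obtains S where "S \<subseteq> pverts G" "S \<noteq> {}" "2 * card S \<le> card (pverts G)"
    "\<And>u w. (u, w) \<in> parcs G \<Longrightarrow> u \<in> S \<Longrightarrow> w \<in> S"
proof -
  let ?V = "pverts G"
  obtain u w where uw: "u \<in> ?V" "w \<in> ?V" "(u, w) \<notin> rtrancl_on ?V ((parcs G)\<^sup>s)"
    using disc fin(2) by (auto simp: connected_conv)
  define R where "R = {y. (u, y) \<in> rtrancl_on ?V ((parcs G)\<^sup>s)}"
  have R: "R \<subseteq> ?V" "u \<in> R" "w \<notin> R"
    using uw by (auto simp: R_def dest: in_rtrancl_on_in_F)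
  have closed: "b \<in> R" if "(a, b) \<in> parcs G" "a \<in> R" for a b
    using that arcs(1) unfolding R_def by (auto simp: symcl_def intro: rtrancl_on_into_rtrancl_on)
  have "card R + card (?V - R) = card ?V"
    using fin R(1) by (metis card_Un_disjoint Diff_disjoint Diff_partition finite_Diff finite_subset)
  then consider "2 * card R \<le> card ?V" | "2 * card (?V - R) \<le> card ?V" by linarith
  then show thesis
  proof cases
    case 1
    then show ?thesis using that[of R] R closed by auto
  next
    case 2
    moreover have "b \<in> ?V - R" if "(a, b) \<in> parcs G" "a \<in> ?V - R" for a b
      using that arcs closed[of b a] by (auto dest: symD)
    ultimately show ?thesis using that[of "?V - R"] R uw by auto
  qed
qed

section \<open>The product measure on copies and its events\<close>

definition copies_pmf :: "'a pair_pre_digraph \<Rightarrow> nat \<Rightarrow> real \<Rightarrow> (nat pair_pre_digraph \<Rightarrow> bool) pmf" where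
  "copies_pmf H n p = Pi_pmf (copies H n) False (\<lambda>_. bernoulli_pmf p)"

text \<open>The deterministic half of \<open>random_graph\<close>: once it is separated from the
  sampling, graph events become events about the independent indicators of the copies.\<close>

definition union_graph :: "'a pair_pre_digraph \<Rightarrow> nat \<Rightarrow> (nat pair_pre_digraph \<Rightarrow> bool) \<Rightarrow> nat pair_pre_digraph" where
  "union_graph H n X = \<lparr>pverts = {1..n}, parcs = (\<Union>C\<in>{C \<in> copies H n. X C}. parcs C)\<rparr>"

lemma prob_random_graph:
  "measure_pmf.prob (random_graph H n p) A = measure_pmf.prob (copies_pmf H n p) {X. union_graph H n X \<in> A}"
  by (simp add: random_graph_def copies_pmf_def union_graph_def[abs_def] vimage_def)

lemma prob_all_absent:
  assumes "D \<subseteq> copies H n" "p \<in> {0..1}"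
  shows "measure_pmf.prob (copies_pmf H n p) {X. \<forall>C\<in>D. \<not> X C} = (1 - p) ^ card D"
proof -
  \<comment> \<open>The event is a product set, with factor \<open>{False}\<close> on
    \<open>D\<close> and no constraint elsewhere, so independence gives its probability as a
    product.\<close>
  let ?B = "\<lambda>C. if C \<in> D then {False} else UNIV"
  have "{X. \<forall>C\<in>D. \<not> X C} = Pi (copies H n) ?B"
    using assms(1) by (fastforce simp: Pi_def split: if_splits)
  then have "measure_pmf.prob (copies_pmf H n p) {X. \<forall>C\<in>D. \<not> X C} =
      (\<Prod>C\<in>copies H n. measure_pmf.prob (bernoulli_pmf p) (?B C))"
    by (simp add: copies_pmf_def measure_Pi_pmf_Pi[OF finite_copies])
  also have "\<dots> = (\<Prod>C\<in>copies H n. if C \<in> D then 1 - p else 1)"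
    using assms(2) by (intro prod.cong) (auto simp: measure_pmf_single)
  also have "\<dots> = (\<Prod>C\<in>D. 1 - p)"
    using assms(1) finite_copies[of H n]
    by (simp add: prod.If_cases Int_absorb1)
  finally show ?thesis by simp
qed

lemma union_graph_props:
  "pverts (union_graph H n X) = {1..n}"
  "parcs (union_graph H n X) \<subseteq> {1..n} \<times> {1..n}"
  "sym (parcs (union_graph H n X))"
proof -
  have C: "u \<in> {1..n} \<and> w \<in> {1..n} \<and> (w, u) \<in> parcs C"
    if "C \<in> copies H n" "(u, w) \<in> parcs C" for C u w
    using that unfolding copies_iff pair_graph_iff by (meson subsetD)
  show "pverts (union_graph H n X) = {1..n}" by (simp add: union_graph_def)
  show "parcs (union_graph H n X) \<subseteq> {1..n} \<times> {1..n}"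
    unfolding union_graph_def using C by fastforce
  show "sym (parcs (union_graph H n X))"
    unfolding union_graph_def sym_def using C by fastforce
qed

text \<open>Union bound over the smaller sides of cuts: a disconnected outcome has some such
  \<open>S\<close> all of whose crossing copies are absent.\<close>

lemma prob_disconnected_le:
  assumes "p \<in> {0..1}" "n \<ge> 1"
  shows "1 - measure_pmf.prob (random_graph H n p) {G. Digraph_Component.connected (with_proj G)}
    \<le> (\<Sum>S\<in>{S. S \<subseteq> {1..n} \<and> S \<noteq> {} \<and> 2 * card S \<le> n}. (1 - p) ^ card (crossing H n S))"
proof -
  let ?P = "copies_pmf H n p" and ?I = "{S. S \<subseteq> {1..n} \<and> S \<noteq> {} \<and> 2 * card S \<le> n}"
  let ?Con = "{X. Digraph_Component.connected (with_proj (union_graph H n X))}"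
  have sub: "UNIV - ?Con \<subseteq> (\<Union>S\<in>?I. {X. \<forall>C\<in>crossing H n S. \<not> X C})"
  proof
    fix X assume X: "X \<in> UNIV - ?Con"
    obtain S where S: "S \<subseteq> {1..n}" "S \<noteq> {}" "2 * card S \<le> n"
      "\<And>u w. (u, w) \<in> parcs (union_graph H n X) \<Longrightarrow> u \<in> S \<Longrightarrow> w \<in> S"
    proof (rule not_connected_small_cut[of "union_graph H n X"])
      show "\<not> Digraph_Component.connected (with_proj (union_graph H n X))" using X by simp
    qed (use assms(2) union_graph_props[of H n X] in auto)
    have "\<not> X C" if "C \<in> crossing H n S" for C
      using that S(4) by (auto simp: crossing_def union_graph_def)
    with S show "X \<in> (\<Union>S\<in>?I. {X. \<forall>C\<in>crossing H n S. \<not> X C})" by blast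
  qed
  have "finite ?I" by (rule finite_subset[of _ "Pow {1..n}"]) auto
  have "1 - measure_pmf.prob ?P ?Con = measure_pmf.prob ?P (UNIV - ?Con)"
    using measure_pmf.prob_compl[of ?Con ?P] by simp
  also have "\<dots> \<le> measure_pmf.prob ?P (\<Union>S\<in>?I. {X. \<forall>C\<in>crossing H n S. \<not> X C})"
    using sub by (rule measure_pmf.finite_measure_mono) simp
  also have "\<dots> \<le> (\<Sum>S\<in>?I. measure_pmf.prob ?P {X. \<forall>C\<in>crossing H n S. \<not> X C})"
    using \<open>finite ?I\<close> by (intro measure_pmf.finite_measure_subadditive_finite) auto
  also have "\<dots> = (\<Sum>S\<in>?I. (1 - p) ^ card (crossing H n S))"
    using assms(1) by (intro sum.cong prob_all_absent) (auto simp: crossing_def)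
  finally show ?thesis by (simp add: prob_random_graph)
qed

text \<open>Second moment method for the events \<open>?E u\<close> that \<open>u\<close> is
  isolated. By inclusion-exclusion \<open>2 * m1 H n - m2 H n\<close> copies meet a given pair of
  vertices, so the correlation ratio \<open>?r / ?q\<^sup>2\<close> is
  \<open>1 / (1 - p) ^ m2 H n\<close>.\<close>

lemma prob_connected_le:
  assumes p: "0 \<le> p" "p < 1" and n: "n \<ge> 2"
  shows "measure_pmf.prob (random_graph H n p) {G. Digraph_Component.connected (with_proj G)}
    \<le> 1 / (n * (1 - p) ^ m1 H n) + 1 / (1 - p) ^ m2 H n - 1"
proof -
  let ?P = "copies_pmf H n p"
  let ?q = "(1 - p) ^ m1 H n" and ?r = "(1 - p) ^ (2 * m1 H n - m2 H n)"
  let ?A = "\<lambda>u. {C \<in> copies H n. u \<in> pverts C}"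
  let ?E = "\<lambda>u. {X. \<forall>C\<in>?A u. \<not> X C}"
  have "m2 H n \<le> m1 H n" unfolding m1_def m2_def by (intro card_mono) (auto simp: finite_copies)
  then have r_eq: "?r / ?q\<^sup>2 = 1 / (1 - p) ^ m2 H n"
    using p by (simp add: power_diff power_mult[symmetric] mult.commute)
  have "measure_pmf.prob (random_graph H n p) {G. Digraph_Component.connected (with_proj G)}
      = measure_pmf.prob ?P {X. Digraph_Component.connected (with_proj (union_graph H n X))}"
    by (simp add: prob_random_graph)
  also have "\<dots> \<le> measure_pmf.prob ?P {X. \<forall>u\<in>{1..n}. X \<notin> ?E u}"
  proof (rule measure_pmf.finite_measure_mono)
    show "{X. Digraph_Component.connected (with_proj (union_graph H n X))} \<subseteq> {X. \<forall>u\<in>{1..n}. X \<notin> ?E u}"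
    proof safe
      fix X u
      assume X: "Digraph_Component.connected (with_proj (union_graph H n X))"
        "u \<in> {1..n}" "\<forall>C\<in>?A u. \<not> X C"
      \<comment> \<open>A second vertex is what makes isolation contradict connectivity; a single
        vertex would be isolated and connected.\<close>
      obtain w where "w \<in> {1..n}" "w \<noteq> u"
        using n by (cases "u = 1") (auto intro: that[of 1] that[of 2])
      then obtain c where "(u, c) \<in> parcs (union_graph H n X) \<or> (c, u) \<in> parcs (union_graph H n X)"
        using connected_imp_incident_arc[OF X(1), of u w] X(2) by (auto simp: union_graph_props)
      then obtain C where "C \<in> copies H n" "X C" "(u, c) \<in> parcs C \<or> (c, u) \<in> parcs C"
        by (auto simp: union_graph_def)
      then show False using X(3) by (auto simp: copies_iff pair_graph_iff)
    qed
  qed simp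
  also have "\<dots> \<le> 1 / (card {1..n} * ?q) + ?r / ?q\<^sup>2 - 1"
  proof (rule second_moment_none[where E = ?E])
    show "measure_pmf.prob ?P (?E u) = ?q" if "u \<in> {1..n}" for u
      using prob_all_absent[of "?A u" H n p] card_copies_containing[OF that, of H] p by simp
    show "measure_pmf.prob ?P (?E u \<inter> ?E w) = ?r" if uw: "u \<in> {1..n}" "w \<in> {1..n}" "u \<noteq> w" for u w
    proof -
      have "card (?A u \<union> ?A w) + card (?A u \<inter> ?A w) = card (?A u) + card (?A w)"
        using card_Un_Int[of "?A u" "?A w"] by (simp add: finite_copies)
      moreover have "?A u \<inter> ?A w = {C \<in> copies H n. u \<in> pverts C \<and> w \<in> pverts C}" by blast
      ultimately have "card (?A u \<union> ?A w) = 2 * m1 H n - m2 H n"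
        using uw by (simp add: card_copies_containing card_copies_containing_pair)
      moreover have "?E u \<inter> ?E w = {X. \<forall>C\<in>?A u \<union> ?A w. \<not> X C}" by blast
      ultimately show ?thesis using prob_all_absent[of "?A u \<union> ?A w" H n p] p by auto
    qed
  qed (use p n in auto)
  finally show ?thesis using r_eq by simp
qed

section \<open>Asymptotics\<close>

text \<open>Exponentiates \<open>ln (1 - p) \<ge> - p - 2 * p\<^sup>2\<close>, valid for
  \<open>p\<close> up to 1/2.\<close>

lemma power_one_minus_ge_exp:
  fixes p :: real
  assumes "0 \<le> p" "p \<le> 1/2"
  shows "exp (- ((p + 2 * p\<^sup>2) * real k)) \<le> (1 - p) ^ k"
proof -
  have "exp (- p - 2 * p\<^sup>2) \<le> 1 - p"
    using ln_one_minus_pos_lower_bound[OF assms] assms by (simp add: ln_ge_iff)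
  then have "exp (- p - 2 * p\<^sup>2) ^ k \<le> (1 - p) ^ k" by (intro power_mono) auto
  then show ?thesis by (simp add: exp_of_nat_mult[symmetric] algebra_simps)
qed

lemma power_one_minus_le_exp:
  fixes p :: real
  assumes "p \<le> 1"
  shows "(1 - p) ^ k \<le> exp (- (p * real k))"
proof -
  have "(1 - p) ^ k \<le> exp (- p) ^ k"
    using exp_ge_add_one_self[of "- p"] assms by (intro power_mono) auto
  then show ?thesis by (simp add: exp_of_nat_mult[symmetric] mult.commute)
qed

text \<open>The left side divided by \<open>fact s\<close> is a single term of the exponential
  series at \<open>s\<close>. This replaces Stirling's formula.\<close>

lemma power_self_le_exp_fact: "real s ^ s \<le> exp (real s) * fact s"
proof -
  have "(\<Sum>k\<in>{s}. real s ^ k /\<^sub>R fact k) \<le> (\<Sum>k. real s ^ k /\<^sub>R fact k)"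
    using exp_converges[of "real s"] by (intro sum_le_suminf) (auto simp: sums_iff)
  then have "real s ^ s /\<^sub>R fact s \<le> exp (real s)"
    using exp_converges[of "real s"] by (simp add: sums_iff)
  then show ?thesis by (simp add: field_simps)
qed

lemma sum_subsets_by_card:
  fixes f :: "nat \<Rightarrow> real"
  shows "(\<Sum>S\<in>{S. S \<subseteq> {1..n} \<and> S \<noteq> {}}. f (card S)) = (\<Sum>s\<in>{1..n}. (n choose s) * f s)"
proof -
  let ?I = "{S. S \<subseteq> {1..n} \<and> S \<noteq> {}}"
  have fin: "finite ?I" by (rule finite_subset[of _ "Pow {1..n}"]) auto
  have sub: "card ` ?I \<subseteq> {1..n}"
  proof (rule image_subsetI)
    fix S assume "S \<in> ?I"
    then have S: "S \<subseteq> {1..n}" "S \<noteq> {}" by auto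
    then have "finite S" using finite_subset by blast
    then show "card S \<in> {1..n}"
      using S card_mono[of "{1..n}" S] by (simp add: Suc_leI card_gt_0_iff)
  qed
  have "(\<Sum>S\<in>?I. f (card S)) = (\<Sum>s\<in>{1..n}. \<Sum>S\<in>{S \<in> ?I. card S = s}. f (card S))"
    by (rule sum.group[symmetric]) (use fin sub in auto)
  also have "\<dots> = (\<Sum>s\<in>{1..n}. (n choose s) * f s)"
  proof (rule sum.cong[OF refl])
    fix s assume "s \<in> {1..n}"
    then have "{S \<in> ?I. card S = s} = {S. S \<subseteq> {1..n} \<and> card S = s}" by auto
    then have "card {S \<in> ?I. card S = s} = n choose s" using n_subsets[of "{1..n}" s] by simp
    then show "(\<Sum>S\<in>{S \<in> ?I. card S = s}. f (card S)) = (n choose s) * f s" by simp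
  qed
  finally show ?thesis .
qed

section \<open>Bounds for fixed n below and above the threshold\<close>

context no_isolated_graph begin

lemma m2_eq:
  assumes "n \<ge> 2"
  shows "real (m2 H n) = m1 H n * (real order - 1) / (real n - 1)"
proof -
  have "real ((n - 1) * m2 H n) = real (m1 H n * (order - 1))" using pair_count[of n] assms by simp
  then show ?thesis using assms order_ge_2 by (simp add: of_nat_diff field_simps)
qed

text \<open>Since \<open>p\<close> is \<open>O(ln n / n)\<close>, the expected number of isolated
  vertices is at least \<open>exp y\<close> up to a factor
  \<open>exp (- O((ln n)\<^sup>2 / n))\<close>, while \<open>p * m2 H n\<close> is
  \<open>O(ln n / n)\<close> and the correlation ratio stays near 1.\<close>

lemma prob_connected_le_subcritical:
  fixes n :: nat and p y :: real
  assumes n: "order \<le> n" and p: "0 \<le> p" "p * m1 H n \<le> ln n - y" and y: "0 \<le> y"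
    and large: "2 * (real order - 1) * ln n / (real n - 1) \<le> 1"
  shows "measure_pmf.prob (random_graph H n p) {G. Digraph_Component.connected (with_proj G)}
    \<le> exp (2 * (real order - 1) * (ln n)\<^sup>2 / (real n - 1) - y)
      + exp (2 * (real order - 1) * ln n / (real n - 1)) - 1"
proof -
  define K where "K = real order - 1"
  have K: "K \<ge> 1" using order_ge_2 by (simp add: K_def)
  have n2: "n \<ge> 2" using n order_ge_2 by simp
  let ?m = "real (m1 H n)"
  have pm: "p * ?m \<le> ln n" using p y by simp
  have p_le: "p \<le> K * ln n / (real n - 1)"
  proof -
    have "p * (real n - 1) \<le> p * (?m * K)"
      using m1_ge[OF n] p(1) unfolding K_def by (rule mult_left_mono)
    also have "\<dots> \<le> ln n * K" using pm K by (simp flip: mult.assoc)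
    finally show ?thesis using n2 by (simp add: field_simps)
  qed
  also have "\<dots> \<le> 1/2" using large[folded K_def] by (simp add: mult.commute mult.left_commute)
  finally have p_half: "p \<le> 1/2" .
  \<comment> \<open>The linear part is the main term; the quadratic correction is
    \<open>2 * p\<close> times it, hence of order \<open>(ln n)\<^sup>2 / n\<close>.\<close>
  have "(p + 2 * p\<^sup>2) * ?m = p * ?m + 2 * p * (p * ?m)" by (simp add: algebra_simps power2_eq_square)
  also have "\<dots> \<le> (ln n - y) + 2 * (K * ln n / (real n - 1)) * ln n"
    using p p_le pm n2 K by (intro add_mono mult_mono) auto
  finally have e1: "(p + 2 * p\<^sup>2) * ?m \<le> ln n - y + 2 * K * (ln n)\<^sup>2 / (real n - 1)"
    by (simp add: power2_eq_square)
  have "exp (y - 2 * K * (ln n)\<^sup>2 / (real n - 1)) \<le> exp (ln n + - ((p + 2 * p\<^sup>2) * ?m))"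
    using e1 by simp
  also have "\<dots> = n * exp (- ((p + 2 * p\<^sup>2) * ?m))" using n2 by (subst exp_add) simp
  also have "\<dots> \<le> n * (1 - p) ^ m1 H n"
    using power_one_minus_ge_exp[OF p(1) p_half] by (intro mult_left_mono) auto
  finally have "1 / (n * (1 - p) ^ m1 H n) \<le> 1 / exp (y - 2 * K * (ln n)\<^sup>2 / (real n - 1))"
    by (intro divide_left_mono) (use p_half n2 in auto)
  also have "\<dots> = exp (2 * K * (ln n)\<^sup>2 / (real n - 1) - y)"
    by (simp add: exp_minus[symmetric] inverse_eq_divide[symmetric])
  finally have b1: "1 / (n * (1 - p) ^ m1 H n) \<le> exp (2 * K * (ln n)\<^sup>2 / (real n - 1) - y)" .
  \<comment> \<open>A factor 2 is harmless here, as the exponent with \<open>m2\<close> tends to 0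
    anyway.\<close>
  have "(p + 2 * p\<^sup>2) \<le> 2 * p" using mult_left_mono[OF p_half p(1)] by (simp add: power2_eq_square)
  then have "(p + 2 * p\<^sup>2) * m2 H n \<le> 2 * p * m2 H n" by (intro mult_right_mono) auto
  also have "\<dots> = 2 * K * (p * ?m) / (real n - 1)" using m2_eq[OF n2] by (simp add: K_def)
  also have "\<dots> \<le> 2 * K * ln n / (real n - 1)"
    using pm K n2 by (intro divide_right_mono mult_left_mono) auto
  finally have "exp (- (2 * K * ln n / (real n - 1))) \<le> exp (- ((p + 2 * p\<^sup>2) * m2 H n))" by simp
  also have "\<dots> \<le> (1 - p) ^ m2 H n" using p(1) p_half by (rule power_one_minus_ge_exp)
  finally have "1 / (1 - p) ^ m2 H n \<le> 1 / exp (- (2 * K * ln n / (real n - 1)))"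
    by (intro divide_left_mono) (use p_half in auto)
  also have "\<dots> = exp (2 * K * ln n / (real n - 1))" by (simp add: exp_minus field_simps)
  finally have b2: "1 / (1 - p) ^ m2 H n \<le> exp (2 * K * ln n / (real n - 1))" .
  have "measure_pmf.prob (random_graph H n p) {G. Digraph_Component.connected (with_proj G)}
      \<le> 1 / (n * (1 - p) ^ m1 H n) + 1 / (1 - p) ^ m2 H n - 1"
    using prob_connected_le[of p n H] p(1) p_half n2 by simp
  with b1 b2 show ?thesis unfolding K_def by linarith
qed

text \<open>At least \<open>s m1 (1 - K s / n)\<close> copies cross, so their absence costs about
  \<open>n ^ (- s) exp (K s\<^sup>2 ln n / n - y s / 2)\<close>. The power of \<open>n\<close>
  cancels against the binomial coefficient, and the error term is controlled by
  \<open>large\<close>.\<close>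

lemma small_cut_bound:
  fixes n s :: nat and p y :: real
  assumes n: "order \<le> n" and p: "p \<in> {0..1}" "ln n + y \<le> p * m1 H n" and y: "0 \<le> y"
    and S: "S \<subseteq> {1..n}" "card S = s" "s \<ge> 1" "2 * (real order - 1) * s \<le> n"
    and large: "exp ((real order - 1) * s * ln n / n) \<le> exp 1 * s"
  shows "(n choose s) * (1 - p) ^ card (crossing H n S) \<le> exp (2 - y / 2) ^ s"
proof -
  define K where "K = real order - 1"
  define c where "c = real (card (crossing H n S))"
  have K: "K \<ge> 1" using order_ge_2 by (simp add: K_def)
  have n2: "n \<ge> 2" using n order_ge_2 by simp
  have "s \<le> n" using S card_mono[of "{1..n}" S] by simp
  let ?m = "real (m1 H n)"
  have "K * (s / n) \<le> 1/2" using S(4) n2 by (simp add: K_def field_simps)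
  then have Ks: "1 - K * (s / n) \<ge> 1/2" by linarith
  then have Ks': "s * (1 - K * (s / n)) \<ge> 0" by (intro mult_nonneg_nonneg) linarith+
  have frac: "(real s - 1) / (real n - 1) \<le> real s / real n"
    using \<open>s \<le> n\<close> n2 by (simp add: field_simps)
  have ln0: "ln n \<ge> 0" using n2 by simp
  have "real (card S * m1 H n) \<le> real (card (crossing H n S) + card S * (card S - 1) * m2 H n)"
    using crossing_ge_inclusion_exclusion[OF S(1)] by (rule of_nat_mono)
  then have "s * ?m \<le> c + s * (real s - 1) * m2 H n"
    using S by (simp add: c_def of_nat_diff)
  then have "c \<ge> s * ?m * (1 - K * ((real s - 1) / (real n - 1)))"
    using m2_eq[OF n2] n2 by (simp add: K_def field_simps)
  moreover have "s * ?m * (1 - K * ((real s - 1) / (real n - 1))) \<ge> s * ?m * (1 - K * (s / n))"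
    using K frac by (intro mult_left_mono diff_left_mono) auto
  ultimately have "c \<ge> s * ?m * (1 - K * (s / n))" by linarith
  then have "p * c \<ge> p * (s * ?m * (1 - K * (s / n)))"
    using p(1) by (intro mult_left_mono) auto
  moreover have "p * (s * ?m * (1 - K * (s / n))) = (p * ?m) * (s * (1 - K * (s / n)))" by simp
  moreover have "(p * ?m) * (s * (1 - K * (s / n))) \<ge> (ln n + y) * (s * (1 - K * (s / n)))"
    using p(2) Ks' by (rule mult_right_mono)
  \<comment> \<open>Half of the \<open>y\<close> term may be given away, but the coefficient of
    \<open>ln n\<close> must be kept exactly: \<open>s * ln n\<close> has to cancel the factor
    \<open>n ^ s\<close>.\<close>
  moreover have "y * (s * (1 - K * (s / n))) \<ge> y * (s * (1/2))"
    using y Ks by (intro mult_left_mono) linarith+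
  moreover have "(ln n + y) * (s * (1 - K * (s / n))) =
      s * ln n - s * (K * s * ln n / n) + y * (s * (1 - K * (s / n)))"
    by (simp add: algebra_simps add_divide_distrib)
  ultimately have "p * c \<ge> s * ln n - s * (K * s * ln n / n) + y * (s * (1/2))" by linarith
  then have "exp (- (p * c)) \<le> exp (s * (K * s * ln n / n - y / 2) - s * ln n)"
    by (simp add: algebra_simps)
  also have "\<dots> = (exp (K * s * ln n / n) * exp (- (y / 2))) ^ s / real n ^ s"
  proof -
    have "exp (s * (K * s * ln n / n - y / 2)) = (exp (K * s * ln n / n) * exp (- (y / 2))) ^ s"
      by (simp only: exp_of_nat_mult exp_add[symmetric]) simp
    moreover have "exp (s * ln n) = real n ^ s" using n2 by (simp add: exp_of_nat_mult)
    ultimately show ?thesis by (simp only: exp_diff)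
  qed
  \<comment> \<open>The power \<open>s ^ s\<close> that enters here is absorbed below by the factor
    \<open>1 / fact s\<close> of the binomial bound, at the price of another
    \<open>exp 1 ^ s\<close>.\<close>
  also have "\<dots> \<le> (exp 1 * s * exp (- (y / 2))) ^ s / real n ^ s"
    using large by (intro divide_right_mono power_mono mult_right_mono) (auto simp: K_def)
  finally have exp_le: "exp (- (p * c)) \<le> (exp 1 * s * exp (- (y / 2))) ^ s / real n ^ s" .
  have "real ((n choose s) * fact s) \<le> real (n ^ s)"
    using binomial_fact_pow by (rule of_nat_mono)
  then have binom: "real (n choose s) \<le> real n ^ s / fact s" by (simp add: field_simps)
  have "(n choose s) * (1 - p) ^ card (crossing H n S) \<le> (n choose s) * exp (- (p * c))"
    using power_one_minus_le_exp[of p] p(1) unfolding c_def by (intro mult_left_mono) auto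
  also have "\<dots> \<le> real n ^ s / fact s * ((exp 1 * s * exp (- (y / 2))) ^ s / real n ^ s)"
    using binom exp_le by (intro mult_mono) auto
  also have "\<dots> = exp 1 ^ s * exp (- (y / 2)) ^ s * (real s ^ s / fact s)"
    using n2 by (simp add: power_mult_distrib)
  also have "\<dots> \<le> exp 1 ^ s * exp (- (y / 2)) ^ s * exp 1 ^ s"
    using power_self_le_exp_fact[of s]
    by (intro mult_left_mono) (auto simp: field_simps exp_of_nat_mult[symmetric])
  also have "\<dots> = exp (2 - y / 2) ^ s"
    by (simp add: power_mult_distrib[symmetric] exp_add[symmetric] del: power_mult_distrib)
  finally show ?thesis .
qed

text \<open>With \<open>n - s \<ge> n / 2\<close>, the arc average gives
  \<open>s m1 \<le> 2 order c\<close> for the number \<open>c\<close> of crossing copies.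
  Multiplying by \<open>p\<close> and using \<open>s > n / (2 K)\<close> makes \<open>p * c\<close>
  of order \<open>n ln n\<close>.\<close>

lemma large_cut_bound:
  fixes n s :: nat and p y :: real
  assumes n: "order \<le> n" and p: "p \<in> {0..1}" "ln n \<le> p * m1 H n"
    and S: "S \<subseteq> {1..n}" "card S = s" "2 * s \<le> n" "2 * (real order - 1) * s > n"
  shows "(1 - p) ^ card (crossing H n S) \<le> exp (- (n * ln n / (4 * (real order - 1) * order)))"
proof -
  define K where "K = real order - 1"
  define c where "c = real (card (crossing H n S))"
  have K: "K \<ge> 1" using order_ge_2 by (simp add: K_def)
  have n2: "n \<ge> 2" using n order_ge_2 by simp
  have v: "real order > 0" using order_ge_2 by simp
  let ?m = "real (m1 H n)"
  have "real (card S * (n - card S) * m1 H n) \<le> real (order * (n - 1) * card (crossing H n S))"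
    using crossing_ge_arcs[OF S(1)] by (rule of_nat_mono)
  then have "s * (real n - s) * ?m \<le> order * (real n - 1) * c"
    using S n2 by (simp add: c_def of_nat_diff)
  moreover have "order * (real n - 1) * c \<le> order * real n * c"
    by (intro mult_right_mono mult_left_mono) (auto simp: c_def)
  moreover have "s * (real n / 2) * ?m \<le> s * (real n - s) * ?m"
    using S(3) by (intro mult_right_mono mult_left_mono) (simp_all add: field_simps)
  ultimately have "real n * (s * ?m) \<le> real n * (2 * order * c)" by (simp add: algebra_simps)
  then have "s * ?m \<le> 2 * order * c" using n2 by simp
  then have "p * (s * ?m) \<le> p * (2 * order * c)" using p by (intro mult_left_mono) auto
  moreover have "s * ln n \<le> s * (p * ?m)" using p by (intro mult_left_mono) auto
  ultimately have "s * ln n \<le> 2 * order * (p * c)" by (simp add: algebra_simps)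
  moreover have "n * ln n \<le> 2 * K * s * ln n"
    using S(4) n2 by (intro mult_right_mono) (auto simp: K_def)
  moreover have "2 * K * (s * ln n) \<le> 2 * K * (2 * order * (p * c))"
    using calculation(1) K by (intro mult_left_mono) auto
  ultimately have "n * ln n \<le> p * c * (4 * K * order)" by (simp add: algebra_simps)
  then have "n * ln n / (4 * K * order) \<le> p * c"
    using K v by (simp add: divide_le_eq)
  moreover have "(1 - p) ^ card (crossing H n S) \<le> exp (- (p * c))"
    using power_one_minus_le_exp[of p] p(1) unfolding c_def by auto
  ultimately show ?thesis unfolding K_def by (meson exp_le_cancel_iff le_imp_neg_le order_trans)
qed

text \<open>Each cut is bounded by the sum of the small-cut and large-cut bounds. The small-cut part
  carries one over the binomial coefficient, so summing over all sets of size \<open>s\<close>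
  leaves \<open>?\<rho> ^ s\<close>, a geometric series that converges because \<open>y > 4\<close>.
  The large-cut part is multiplied by at most \<open>2 ^ n\<close>.\<close>

lemma prob_disconnected_le_supercritical:
  fixes n :: nat and p y :: real
  assumes n: "order \<le> n" and p: "p \<in> {0..1}" "ln n + y \<le> p * m1 H n" and y: "4 < y"
    and large: "\<And>s. s \<ge> 1 \<Longrightarrow> 2 * (real order - 1) * real s \<le> n
      \<Longrightarrow> exp ((real order - 1) * real s * ln n / n) \<le> exp 1 * real s"
  shows "1 - measure_pmf.prob (random_graph H n p) {G. Digraph_Component.connected (with_proj G)}
    \<le> exp (2 - y / 2) / (1 - exp (2 - y / 2))
      + 2 ^ n * exp (- (n * ln n / (4 * (real order - 1) * order)))"
proof -
  let ?I = "{S. S \<subseteq> {1..n} \<and> S \<noteq> {} \<and> 2 * card S \<le> n}"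
  let ?J = "{S. S \<subseteq> {1..n} \<and> S \<noteq> {}}"
  let ?\<rho> = "exp (2 - y / 2)"
  let ?g = "exp (- (n * ln n / (4 * (real order - 1) * order)))"
  have finJ: "finite ?J" by (rule finite_subset[of _ "Pow {1..n}"]) auto
  have \<rho>: "?\<rho> < 1" using y by simp
  have n2: "n \<ge> 2" using n order_ge_2 by simp
  have bound: "(1 - p) ^ card (crossing H n S) \<le> ?\<rho> ^ card S / (n choose card S) + ?g"
    if S: "S \<in> ?I" for S
  proof (cases "2 * (real order - 1) * card S \<le> n")
    case True
    have "finite S" using S finite_subset by blast
    then have "card S \<ge> 1" using S by (simp add: Suc_leI card_gt_0_iff)
    then have "(n choose card S) * (1 - p) ^ card (crossing H n S) \<le> ?\<rho> ^ card S"
      using small_cut_bound[OF n p _ _ refl _ True] S y large[OF _ True] by simp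
    moreover have "n choose card S > 0" using S by simp
    ultimately have "(1 - p) ^ card (crossing H n S) \<le> ?\<rho> ^ card S / (n choose card S)"
      by (simp add: le_divide_eq mult.commute)
    then show ?thesis by (rule add_increasing2[rotated]) simp
  next
    case False
    then have "(1 - p) ^ card (crossing H n S) \<le> ?g"
      using large_cut_bound[OF n p(1) _ _ refl] S y p(2) by simp
    then show ?thesis by (rule add_increasing[rotated]) simp
  qed
  have "1 - measure_pmf.prob (random_graph H n p) {G. Digraph_Component.connected (with_proj G)}
      \<le> (\<Sum>S\<in>?I. (1 - p) ^ card (crossing H n S))"
    using prob_disconnected_le[OF p(1), of n H] n2 by simp
  also have "\<dots> \<le> (\<Sum>S\<in>?I. ?\<rho> ^ card S / (n choose card S) + ?g)"
    using bound by (rule sum_mono)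
  \<comment> \<open>Dropping the size restriction adds nonnegative terms and allows grouping by
    cardinality.\<close>
  also have "\<dots> \<le> (\<Sum>S\<in>?J. ?\<rho> ^ card S / (n choose card S) + ?g)"
    using finJ by (intro sum_mono2) auto
  also have "\<dots> = (\<Sum>S\<in>?J. ?\<rho> ^ card S / (n choose card S)) + card ?J * ?g"
    by (simp add: sum.distrib)
  also have "(\<Sum>S\<in>?J. ?\<rho> ^ card S / (n choose card S)) = (\<Sum>s\<in>{1..n}. ?\<rho> ^ s)"
    using sum_subsets_by_card[of "\<lambda>s. ?\<rho> ^ s / (n choose s)" n] by simp
  also have "(\<Sum>s\<in>{1..n}. ?\<rho> ^ s) \<le> ?\<rho> / (1 - ?\<rho>)"
  proof -
    have "(\<Sum>s\<in>{1..n}. ?\<rho> ^ s) = ?\<rho> * (\<Sum>s<n. ?\<rho> ^ s)"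
      by (simp add: sum_distrib_left lessThan_Suc_atMost sum.atLeast1_atMost_eq)
    also have "(\<Sum>s<n. ?\<rho> ^ s) \<le> (\<Sum>s. ?\<rho> ^ s)"
      using \<rho> by (intro sum_le_suminf summable_geometric) auto
    also have "(\<Sum>s. ?\<rho> ^ s) = 1 / (1 - ?\<rho>)" using \<rho> by (intro suminf_geometric) simp
    finally show ?thesis by simp
  qed
  also have "real (card ?J) \<le> 2 ^ n"
  proof -
    have "card ?J \<le> card (Pow {1..n})" by (intro card_mono) auto
    then have "card ?J \<le> 2 ^ n" by (simp add: card_Pow)
    then have "real (card ?J) \<le> real (2 ^ n)" by (rule of_nat_mono)
    then show ?thesis by simp
  qed
  finally show ?thesis by simp
qed

text \<open>Split at \<open>s = sqrt n\<close>. Below, the exponent is at most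
  \<open>K ln n / sqrt n\<close>, eventually below 1; above, \<open>2 K s \<le> n\<close> bounds it
  by \<open>ln n / 2 = ln (sqrt n)\<close>, which is less than \<open>ln s\<close>.\<close>

lemma eventually_exp_le:
  assumes "K \<ge> (0::real)"
  shows "\<forall>\<^sub>F n :: nat in sequentially. \<forall>s::nat. s \<ge> 1 \<longrightarrow> 2 * K * real s \<le> n \<longrightarrow>
    exp (K * real s * ln n / n) \<le> exp 1 * real s"
proof -
  have "(\<lambda>n. K * ln (real n) / sqrt n) \<longlonglongrightarrow> 0" by real_asymp
  then have "\<forall>\<^sub>F n in sequentially. K * ln (real n) / sqrt n < 1" by (rule order_tendstoD) simp
  then show ?thesis using eventually_ge_at_top[of 1]
  proof eventually_elim
    case (elim n)
    show ?case
    proof (intro allI impI)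
      fix s :: nat assume s: "s \<ge> 1" "2 * K * real s \<le> n"
      have ln0: "ln (real n) \<ge> 0" using elim by simp
      have sq: "sqrt n * sqrt n = n" "sqrt n > 0" using elim by auto
      show "exp (K * real s * ln n / n) \<le> exp 1 * real s"
      proof (cases "real s \<le> sqrt n")
        case True
        have "K * real s * ln n / n \<le> K * sqrt n * ln n / n"
          using True assms ln0 by (intro divide_right_mono mult_right_mono mult_left_mono) auto
        also have "\<dots> = K * ln n / sqrt n" using sq by (simp add: field_simps)
        also have "\<dots> \<le> 1" using elim by simp
        finally have "exp (K * real s * ln n / n) \<le> exp 1 * 1" by simp
        also have "\<dots> \<le> exp 1 * real s" using s by (intro mult_left_mono) auto
        finally show ?thesis .
      next
        case False
        have "K * real s * ln n / n = (2 * K * real s / n) * (ln n / 2)" by simp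
        also have "\<dots> \<le> 1 * (ln n / 2)"
          using s elim ln0 by (intro mult_right_mono) auto
        also have "\<dots> = ln (sqrt n)" using elim by (simp add: ln_sqrt)
        also have "\<dots> \<le> ln s" using False sq s by simp
        finally have "exp (K * real s * ln n / n) \<le> exp (ln s)" by simp
        also have "\<dots> = 1 * real s" using s by simp
        also have "\<dots> \<le> exp 1 * real s" by (intro mult_right_mono) auto
        finally show ?thesis .
      qed
    qed
  qed
qed

text \<open>The reciprocal of a positive minimum degree lies in \<open>(0, 1]\<close>, so its
  ceiling is 1. This removes the \<open>ln (ln n)\<close> term from both thresholds.\<close>

lemma delta_d_1: "delta_d 1 H = 0"
proof -
  have "finite (pverts H)" using graph by (simp add: pair_graph_iff)
  then have "min_degree H \<in> out_degree (with_proj H) ` pverts H"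
    unfolding min_degree_def using nonempty by (intro Min_in) auto
  then have "min_degree H \<ge> 1" using no_isolated by (auto simp: Suc_le_eq)
  then have "\<lceil>1 / real (min_degree H)\<rceil> = 1" by (intro ceiling_unique) auto
  then show ?thesis by (simp add: delta_d_def)
qed

section \<open>The limits on both sides of the threshold\<close>

lemma subcritical_disconnected:
  fixes x p :: "nat \<Rightarrow> real"
  assumes x: "filterlim x at_top sequentially" and p: "\<And>n. p n \<in> {0..1}"
    and le: "\<forall>\<^sub>F n in sequentially. p n \<le> p_minus 1 H x n"
  shows "(\<lambda>n. measure_pmf.prob (random_graph H n (p n))
    {G. Digraph_Component.connected (with_proj G)}) \<longlonglongrightarrow> 0"
proof (rule tendsto_sandwich[where f = "\<lambda>_. 0"])
  define K where "K = real order - 1"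
  \<comment> \<open>The first exponential tends to 0, because the correction vanishes while
    \<open>x n\<close> diverges; the second tends to 1 and cancels the final 1.\<close>
  let ?u = "\<lambda>n. exp (2 * K * (ln (real n))\<^sup>2 / (real n - 1) - x n)
      + exp (2 * K * ln (real n) / (real n - 1)) - 1"
  have "(\<lambda>n. 2 * K * ln (real n) / (real n - 1)) \<longlonglongrightarrow> 0" by real_asymp
  note lim = this
  then have "\<forall>\<^sub>F n in sequentially. 2 * K * ln (real n) / (real n - 1) < 1"
    by (rule order_tendstoD) simp
  moreover have "\<forall>\<^sub>F n in sequentially. x n \<ge> 0" using x by (simp add: filterlim_at_top)
  ultimately show "\<forall>\<^sub>F n in sequentially. measure_pmf.prob (random_graph H n (p n))
      {G. Digraph_Component.connected (with_proj G)} \<le> ?u n"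
    using le eventually_ge_at_top[of order]
  proof eventually_elim
    case (elim n)
    have "p n * m1 H n \<le> ln n - x n"
      using elim m1_pos[of n] unfolding p_minus_def delta_d_1 by (simp add: le_divide_eq)
    then show ?case
      using prob_connected_le_subcritical[of n "p n" "x n"] elim p[of n] by (simp add: K_def)
  qed
  have "(\<lambda>n. 2 * K * (ln (real n))\<^sup>2 / (real n - 1)) \<longlonglongrightarrow> 0" by real_asymp
  then have "(\<lambda>n. - (2 * K * (ln (real n))\<^sup>2 / (real n - 1))) \<longlonglongrightarrow> - 0" by (rule tendsto_minus)
  from filterlim_tendsto_add_at_top[OF this x]
  have "filterlim (\<lambda>n. 2 * K * (ln (real n))\<^sup>2 / (real n - 1) - x n) at_bot sequentially"
    unfolding filterlim_uminus_at_bot by (simp add: algebra_simps)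
  then have "(\<lambda>n. exp (2 * K * (ln (real n))\<^sup>2 / (real n - 1) - x n)) \<longlonglongrightarrow> 0"
    by (rule filterlim_compose[OF exp_at_bot])
  then have "?u \<longlonglongrightarrow> 0 + exp 0 - 1" using lim by (intro tendsto_intros)
  then show "?u \<longlonglongrightarrow> 0" by simp
qed auto

lemma supercritical_connected:
  fixes x p :: "nat \<Rightarrow> real"
  assumes x: "filterlim x at_top sequentially" and p: "\<And>n. p n \<in> {0..1}"
    and ge: "\<forall>\<^sub>F n in sequentially. p n \<ge> p_plus 1 H x n"
  shows "(\<lambda>n. measure_pmf.prob (random_graph H n (p n))
    {G. Digraph_Component.connected (with_proj G)}) \<longlonglongrightarrow> 1"
proof (rule tendsto_sandwich[where h = "\<lambda>_. 1"])
  define c where "c = 1 / (4 * (real order - 1) * order)"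
  have c: "c > 0" using order_ge_2 by (simp add: c_def)
  \<comment> \<open>The first error term vanishes as \<open>x n\<close> diverges. It is the bound
    for small cuts, the other one for large cuts.\<close>
  let ?l = "\<lambda>n. 1 - (exp (2 - x n / 2) / (1 - exp (2 - x n / 2)) + 2 ^ n * exp (- (n * ln (real n) * c)))"
  have "\<forall>\<^sub>F n in sequentially. x n > 4" using x by (simp add: filterlim_at_top_dense)
  moreover have "real order - 1 \<ge> 0" using order_ge_2 by simp
  note eventually_exp_le[OF this]
  ultimately show "\<forall>\<^sub>F n in sequentially. ?l n \<le> measure_pmf.prob (random_graph H n (p n))
      {G. Digraph_Component.connected (with_proj G)}"
    using ge eventually_ge_at_top[of order]
  proof eventually_elim
    case (elim n)
    have "ln n + x n \<le> p n * m1 H n"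
      using elim m1_pos[of n] unfolding p_plus_def delta_d_1 by (simp add: divide_le_eq)
    then have "1 - measure_pmf.prob (random_graph H n (p n)) {G. Digraph_Component.connected (with_proj G)}
        \<le> exp (2 - x n / 2) / (1 - exp (2 - x n / 2))
        + 2 ^ n * exp (- (n * ln n / (4 * (real order - 1) * order)))"
      using elim p[of n] by (intro prob_disconnected_le_supercritical) auto
    then show ?case by (simp add: c_def)
  qed
  have "filterlim (\<lambda>n. x n * (1/2)) at_top sequentially"
    using x by (intro filterlim_at_top_mult_tendsto_pos[OF tendsto_const]) auto
  from filterlim_tendsto_add_at_top[OF tendsto_const this, of "-2"]
  have "filterlim (\<lambda>n. 2 - x n / 2) at_bot sequentially"
    unfolding filterlim_uminus_at_bot by simp
  then have \<rho>: "(\<lambda>n. exp (2 - x n / 2)) \<longlonglongrightarrow> 0"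
    by (rule filterlim_compose[OF exp_at_bot])
  \<comment> \<open>The factor \<open>n\<close> in the exponent is accompanied by a logarithm, so
    \<open>c * ln n\<close> eventually outgrows \<open>ln 2\<close> for any positive
    \<open>c\<close>.\<close>
  have "(\<lambda>n. 2 ^ n * exp (- (real n * ln (real n) * c))) \<longlonglongrightarrow> 0"
    using c by real_asymp
  with \<rho> have "?l \<longlonglongrightarrow> 1 - (0 / (1 - 0) + 0)" by (intro tendsto_intros) auto
  then show "?l \<longlonglongrightarrow> 1" by simp
qed auto

end

theorem theorem2:
  fixes H :: "'a pair_pre_digraph" and x p :: "nat \<Rightarrow> real"
  assumes "pair_graph H" and "pverts H \<noteq> {}"
    and no_isolated: "\<And>v. v \<in> pverts H \<Longrightarrow> out_degree (with_proj H) v \<noteq> 0"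
    and "filterlim x at_top sequentially" and "x \<in> o(\<lambda>n. ln (ln (real n)))"
    and "\<And>n. p n \<in> {0..1}"
  shows "((\<forall>\<^sub>F n in sequentially. p n \<le> p_minus 1 H x n) \<longrightarrow>
           (\<lambda>n. measure_pmf.prob (random_graph H n (p n))
                  {G. Digraph_Component.connected (with_proj G)}) \<longlonglongrightarrow> 0) \<and>
         ((\<forall>\<^sub>F n in sequentially. p n \<ge> p_plus 1 H x n) \<longrightarrow>
           (\<lambda>n. measure_pmf.prob (random_graph H n (p n))
                  {G. Digraph_Component.connected (with_proj G)}) \<longlonglongrightarrow> 1)"
proof -
  interpret no_isolated_graph H
    using assms(1-3) by (rule no_isolated_graph.intro)
  show ?thesis
    using subcritical_disconnected[where x = x and p = p, OF assms(4,6)]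
      supercritical_connected[where x = x and p = p, OF assms(4,6)] by blast
qed

end
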